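(* Let $a\ge 0$, $k\ge 1$, $n\ge 1$ be integers and let $m=a+k$. Let $A_1=(a+1,1),\ A_2=(a+2,1),\ \ldots,\ A_k=(m,1)$, and $\mathcal A=(A_1,\ldots,A_k)$. Let $B_1=(1,b_1),\ldots,B_k=(1,b_k)$ for some integers $1\le b_1<b_2<\cdots<b_k\le n$, and $\mathcal B=(B_1,\ldots,B_k)$. Then the multivariate rational function $$F_{\mathcal A,\mathcal B}(x_1,\ldots,x_m\mid y_1,\ldots,y_n)=\sum_{\Upsilon:\,\mathcal A\to\mathcal B} w(\Upsilon)$$ is symmetric in $(x_1,\ldots,x_m)$.
   Context: Let $[m\times n]=\{(p,q)\in\mathbb N^2: 1\le p\le m,\ 1\le q\le n\}$, with matrix coordinates: the first coordinate (row index) increases downwards and the second coordinate (column index) increases from left to right. A lattice path $\gamma:A\to B$ is a sequence of points of $[m\times n]$ starting at $A$ and ending at $B$ using only Up steps $(p,q)\to(p-1,q)$ and Right steps $(p,q)\to(p,q+1)$ (a path with no steps is allowed when $A=B$); it is identified with the set of points it visits, including both endpoints. For $k$-tuples of points $\mathcal A=(A_1,\ldots,A_k)$ and $\mathcal B=(B_1,\ldots,B_k)$ in $[m\times n]$, $\Upsilon:\mathcal A\to\mathcal B$ denotes a collection $\Upsilon=(\gamma_1,\ldots,\gamma_k)$ of non-intersecting (pairwise having no common point) lattice paths $\gamma_i:A_i\to B_i$. The weights are $$w(\gamma)=\prod_{(i,j)\in\gamma}\frac1{x_i+y_j},\qquad w(\Upsilon)=\prod_{i=1}^k w(\gamma_i),$$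 where $x_1,\ldots,x_m,y_1,\ldots,y_n$ are independent variables. The sum defining $F_{\mathcal A,\mathcal B}$ is over all such collections $\Upsilon$ (an empty sum is $0$). Symmetric in $(x_1,\ldots,x_m)$ means invariant, as a rational function, under all permutations of $x_1,\ldots,x_m$ with the $y_j$ fixed. *)

theory Defs
  imports
    "HOL-Library.Poly_Mapping"
    "HOL-Library.Disjoint_Sets"
    "HOL-Library.FuncSet"
    "HOL-Computational_Algebra.Fraction_Field"
    "HOL-Combinatorics.Permutations"
begin

section \<open>Rational functions in the variables \<open>x\<^sub>i\<close> and \<open>y\<^sub>j\<close>\<close>

datatype xyvar = X nat | Y nat

text \<open>
  The order on variables has no mathematical content: it only gives access to the library
  instance by which the polynomial ring below is an integral domain.
\<close>

instantiation xyvar :: linorder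
begin

fun xyvar_code :: "xyvar \<Rightarrow> nat" where
  "xyvar_code (X i) = 2 * i"
| "xyvar_code (Y j) = 2 * j + 1"

definition less_eq_xyvar :: "xyvar \<Rightarrow> xyvar \<Rightarrow> bool"
  where "u \<le> v \<longleftrightarrow> xyvar_code u \<le> xyvar_code v"

definition less_xyvar :: "xyvar \<Rightarrow> xyvar \<Rightarrow> bool"
  where "u < v \<longleftrightarrow> xyvar_code u < xyvar_code v"

instance
proof
  fix u v :: xyvar
  assume "u \<le> v" and "v \<le> u"
  then have "xyvar_code u = xyvar_code v"
    unfolding less_eq_xyvar_def by (rule antisym)
  then show "u = v"
    by (cases u; cases v) (simp_all, presburger+)
qed (auto simp: less_eq_xyvar_def less_xyvar_def)

end

text \<open>
  A monomial is its finitely supported exponent function. The variables are indexed by all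
  natural numbers; rational functions in \<open>x\<^sub>1, \<dots>, x\<^sub>m, y\<^sub>1, \<dots>, y\<^sub>n\<close> form a subfield.
\<close>

type_synonym 'k mvpoly = "(xyvar \<Rightarrow>\<^sub>0 nat) \<Rightarrow>\<^sub>0 'k"
type_synonym 'k ratfun = "'k mvpoly fract"

definition Var :: "xyvar \<Rightarrow> 'k::field ratfun"
  where "Var v = Fract (Poly_Mapping.single (Poly_Mapping.single v 1) 1) 1"

text \<open>
  The coefficient of a monomial \<open>e\<close> in \<open>rename_poly \<sigma> p\<close> is the coefficient of \<open>e \<circ> \<sigma>\<close> in \<open>p\<close>;
  for bijective \<open>\<sigma>\<close> this replaces each variable \<open>v\<close> by \<open>\<sigma> v\<close>. (The library's \<open>map_key f\<close> is
  unspecified for non-injective \<open>f\<close>.)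
\<close>

definition rename_poly :: "(xyvar \<Rightarrow> xyvar) \<Rightarrow> 'k::field mvpoly \<Rightarrow> 'k mvpoly"
  where "rename_poly \<sigma> = Poly_Mapping.map_key (Poly_Mapping.map_key \<sigma>)"

lemma bij_map_key:
  fixes \<sigma> :: "xyvar \<Rightarrow> xyvar"
  assumes "bij \<sigma>"
  shows "bij (Poly_Mapping.map_key \<sigma> :: (xyvar \<Rightarrow>\<^sub>0 nat) \<Rightarrow> _)"
proof (rule o_bij[where g = "Poly_Mapping.map_key (inv \<sigma>)"])
  have i: "inj \<sigma>" "inj (inv \<sigma>)"
    using assms by (auto simp: bij_is_inj bij_imp_bij_inv)
  have e: "inv \<sigma> \<circ> \<sigma> = (\<lambda>v. v)" "\<sigma> \<circ> inv \<sigma> = (\<lambda>v. v)"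
    using assms by (auto simp: fun_eq_iff bij_is_inj bij_is_surj surj_f_inv_f)
  show "Poly_Mapping.map_key (inv \<sigma>) \<circ> Poly_Mapping.map_key \<sigma> = (id :: (xyvar \<Rightarrow>\<^sub>0 nat) \<Rightarrow> _)"
    by (auto simp: fun_eq_iff map_key_compose[OF i(2) i(1)] e map_key_id)
  show "Poly_Mapping.map_key \<sigma> \<circ> Poly_Mapping.map_key (inv \<sigma>) = (id :: (xyvar \<Rightarrow>\<^sub>0 nat) \<Rightarrow> _)"
    by (auto simp: fun_eq_iff map_key_compose[OF i(1) i(2)] e map_key_id)
qed

lemma lookup_map_key:
  "inj f \<Longrightarrow> Poly_Mapping.lookup (Poly_Mapping.map_key f p) v = Poly_Mapping.lookup p (f v)"
  by (simp add: map_key.rep_eq)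

lemma Sum_any_bij:
  fixes g :: "'a \<Rightarrow> 'b::comm_monoid_add"
  assumes "bij h"
  shows "Sum_any (\<lambda>v. g (h v)) = Sum_any g"
  by (rule Sum_any.reindex_cong[OF assms, symmetric]) (simp add: comp_def)

lemma rename_poly_mult:
  fixes p q :: "'k::field mvpoly"
  assumes "bij \<sigma>"
  shows "rename_poly \<sigma> (p * q) = rename_poly \<sigma> p * rename_poly \<sigma> q"
proof (rule poly_mapping_eqI)
  fix e :: "xyvar \<Rightarrow>\<^sub>0 nat"
  let ?t = "Poly_Mapping.map_key \<sigma> :: (xyvar \<Rightarrow>\<^sub>0 nat) \<Rightarrow> _"
  have t: "bij ?t" using bij_map_key[OF assms] .
  have add: "?t (u + v) = ?t u + ?t v" for u v
    by (rule map_key_plus[OF bij_is_inj[OF assms]])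
  have eq: "?t u = ?t v \<longleftrightarrow> u = v" for u v
    using bij_is_inj[OF t] by (auto dest: injD)
  have "Poly_Mapping.lookup (p * q) (?t e) =
      (\<Sum>l. Poly_Mapping.lookup p (?t l) *
         (\<Sum>r. Poly_Mapping.lookup q (?t r) when ?t e = ?t l + ?t r))"
    unfolding lookup_mult
    by (subst Sum_any_bij[OF t, symmetric], rule Sum_any.cong,
        rule arg_cong[where f = "(*) _"], rule Sum_any_bij[OF t, symmetric])
  then show "Poly_Mapping.lookup (rename_poly \<sigma> (p * q)) e =
      Poly_Mapping.lookup (rename_poly \<sigma> p * rename_poly \<sigma> q) e"
    by (simp add: rename_poly_def lookup_mult lookup_map_key[OF bij_is_inj[OF t]]
        add[symmetric] eq)
qed

lemma rename_poly_eq_0_iff: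
  fixes p :: "'k::field mvpoly"
  assumes "bij \<sigma>"
  shows "rename_poly \<sigma> p = 0 \<longleftrightarrow> p = 0"
proof
  have t: "bij (Poly_Mapping.map_key \<sigma> :: (xyvar \<Rightarrow>\<^sub>0 nat) \<Rightarrow> _)"
    using bij_map_key[OF assms] .
  assume *: "rename_poly \<sigma> p = 0"
  show "p = 0"
  proof (rule poly_mapping_eqI)
    fix e :: "xyvar \<Rightarrow>\<^sub>0 nat"
    obtain d where "e = Poly_Mapping.map_key \<sigma> d"
      using bij_is_surj[OF t] by (metis surjD)
    then show "Poly_Mapping.lookup p e = Poly_Mapping.lookup 0 e"
      using arg_cong[OF *, of "\<lambda>r. Poly_Mapping.lookup r d"]
      by (simp add: rename_poly_def lookup_map_key[OF bij_is_inj[OF t]])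
  qed
next
  assume "p = 0"
  then show "rename_poly \<sigma> p = 0"
    using bij_is_inj[OF bij_map_key[OF assms]] by (simp add: rename_poly_def)
qed

text \<open>
  The case distinction only serves to make the function total: the lifting to fractions is
  well defined for bijective renamings.
\<close>

lift_definition rename :: "(xyvar \<Rightarrow> xyvar) \<Rightarrow> 'k::field ratfun \<Rightarrow> 'k ratfun"
  is "\<lambda>\<sigma> q. if bij \<sigma> then (rename_poly \<sigma> (fst q), rename_poly \<sigma> (snd q)) else q"
proof -
  fix \<sigma> :: "xyvar \<Rightarrow> xyvar" and q r :: "'k mvpoly \<times> 'k mvpoly"
  assume qr: "fractrel q r"
  show "fractrel
      (if bij \<sigma> then (rename_poly \<sigma> (fst q), rename_poly \<sigma> (snd q)) else q)
      (if bij \<sigma> then (rename_poly \<sigma> (fst r), rename_poly \<sigma> (snd r)) else r)"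
  proof (cases "bij \<sigma>")
    case True
    have "rename_poly \<sigma> (fst q * snd r) = rename_poly \<sigma> (fst r * snd q)"
      using qr by (simp only: fractrel_def)
    then have "rename_poly \<sigma> (fst q) * rename_poly \<sigma> (snd r) =
        rename_poly \<sigma> (fst r) * rename_poly \<sigma> (snd q)"
      by (simp only: rename_poly_mult[OF True])
    then show ?thesis
      using qr True by (simp add: fractrel_def rename_poly_eq_0_iff)
  next
    case False
    then show ?thesis
      using qr by simp
  qed
qed

lemma rename_Fract:
  assumes "bij \<sigma>" "q \<noteq> 0"
  shows "rename \<sigma> (Fract p q) = Fract (rename_poly \<sigma> p) (rename_poly \<sigma> q)"
proof -
  have "fractrel (p, q) (p, q)"
    using assms by (simp add: fractrel_def)
  then show ?thesis
    using assms by (simp add: Fract.abs_eq rename.abs_eq rename_poly_eq_0_iff)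
qed

lemma rename_Var:
  assumes "bij \<sigma>"
  shows "rename \<sigma> (Var v :: 'k::field ratfun) = Var (\<sigma> v)"
proof -
  have t: "inj (Poly_Mapping.map_key \<sigma> :: (xyvar \<Rightarrow>\<^sub>0 nat) \<Rightarrow> _)"
    by (rule bij_is_inj[OF bij_map_key[OF assms]])
  have m: "Poly_Mapping.map_key \<sigma> (Poly_Mapping.single (\<sigma> u) (1::nat)) = Poly_Mapping.single u 1" for u
    by (rule map_key_single[OF bij_is_inj[OF assms]])
  have 1: "rename_poly \<sigma> (Poly_Mapping.single (Poly_Mapping.single v 1) (1::'k)) =
      Poly_Mapping.single (Poly_Mapping.single (\<sigma> v) 1) 1"
    using map_key_single[OF t, of "Poly_Mapping.single (\<sigma> v) 1" "1::'k"]
    by (simp only: rename_poly_def m)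
  have "Poly_Mapping.map_key \<sigma> (0 :: xyvar \<Rightarrow>\<^sub>0 nat) = 0"
    by (rule map_key_zero[OF bij_is_inj[OF assms]])
  then have 2: "rename_poly \<sigma> (1 :: 'k mvpoly) = 1"
    using map_key_single[OF t, of 0 "1::'k"] by (simp add: rename_poly_def)
  show ?thesis
    by (simp only: Var_def rename_Fract[OF assms one_neq_zero] 1 2)
qed

fun permute_x :: "(nat \<Rightarrow> nat) \<Rightarrow> xyvar \<Rightarrow> xyvar" where
  "permute_x \<pi> (X i) = X (\<pi> i)"
| "permute_x \<pi> (Y j) = Y j"

lemma bij_permute_x:
  assumes "bij \<pi>"
  shows "bij (permute_x \<pi>)"
proof (rule o_bij[where g = "permute_x (inv \<pi>)"])
  show "permute_x (inv \<pi>) \<circ> permute_x \<pi> = id"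
  proof
    fix v show "(permute_x (inv \<pi>) \<circ> permute_x \<pi>) v = id v"
      using assms by (cases v) (auto simp: bij_is_inj)
  qed
  show "permute_x \<pi> \<circ> permute_x (inv \<pi>) = id"
  proof
    fix v show "(permute_x \<pi> \<circ> permute_x (inv \<pi>)) v = id v"
      using assms by (cases v) (auto simp: bij_is_surj surj_f_inv_f)
  qed
qed

definition symmetric_in_x :: "nat \<Rightarrow> 'k::field ratfun \<Rightarrow> bool"
  where "symmetric_in_x m f \<longleftrightarrow>
    (\<forall>\<pi>. \<pi> permutes {1..m} \<longrightarrow> rename (permute_x \<pi>) f = f)"


section \<open>Non-intersecting lattice paths\<close>

type_synonym point = "nat \<times> nat"

definition grid :: "nat \<Rightarrow> nat \<Rightarrow> point set"
  where "grid m n = {1..m} \<times> {1..n}"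

text \<open>
  Matrix coordinates (row, column): an up step decreases the row index. It is written additively
  because subtraction on natural numbers truncates.
\<close>

definition step :: "point \<Rightarrow> point \<Rightarrow> bool"
  where "step P Q \<longleftrightarrow>
    (fst P = fst Q + 1 \<and> snd Q = snd P) \<or> (fst Q = fst P \<and> snd Q = snd P + 1)"

definition lattice_paths :: "nat \<Rightarrow> nat \<Rightarrow> point \<Rightarrow> point \<Rightarrow> point list set"
  where "lattice_paths m n A B = {\<gamma>. \<gamma> \<noteq> [] \<and> hd \<gamma> = A \<and> last \<gamma> = B \<and>
    set \<gamma> \<subseteq> grid m n \<and> successively step \<gamma>}"

text \<open>
  A \<open>k\<close>-tuple is a function of which only the values on \<open>{1..k}\<close> matter; tuples of paths are
  extensional, so that each is counted once.
\<close>

definition nonintersecting ::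
    "nat \<Rightarrow> nat \<Rightarrow> nat \<Rightarrow> (nat \<Rightarrow> point) \<Rightarrow> (nat \<Rightarrow> point) \<Rightarrow> (nat \<Rightarrow> point list) set"
  where "nonintersecting m n k A B = {\<Upsilon> \<in> (\<Pi>\<^sub>E i\<in>{1..k}. lattice_paths m n (A i) (B i)).
    disjoint_family_on (\<lambda>i. set (\<Upsilon> i)) {1..k}}"

definition path_weight :: "point list \<Rightarrow> 'k::field ratfun"
  where "path_weight \<gamma> = (\<Prod>(i, j)\<in>set \<gamma>. 1 / (Var (X i) + Var (Y j)))"

definition path_sum :: "nat \<Rightarrow> nat \<Rightarrow> nat \<Rightarrow> (nat \<Rightarrow> point) \<Rightarrow> (nat \<Rightarrow> point) \<Rightarrow> 'k::field ratfun"
  where "path_sum m n k A B = (\<Sum>\<Upsilon>\<in>nonintersecting m n k A B. \<Prod>i=1..k. path_weight (\<Upsilon> i))"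

text \<open>The sum is over a finite set, so it does not fall under the convention that infinite sums are 0.\<close>

lemma length_path_le:
  assumes "successively step \<gamma>" "set \<gamma> \<subseteq> grid m n" "\<gamma> \<noteq> []"
  shows "length \<gamma> + snd (hd \<gamma>) \<le> fst (hd \<gamma>) + n"
  using assms
proof (induction \<gamma> rule: induct_list012)
  case (3 P Q \<gamma>)
  then show ?case by (auto simp: step_def)
qed (auto simp: grid_def)

lemma finite_lattice_paths: "finite (lattice_paths m n A B)"
proof (rule finite_subset)
  show "lattice_paths m n A B \<subseteq> {\<gamma>. set \<gamma> \<subseteq> grid m n \<and> length \<gamma> \<le> m + n + 1}"
  proof
    fix \<gamma> assume "\<gamma> \<in> lattice_paths m n A B"
    then have *: "successively step \<gamma>" "set \<gamma> \<subseteq> grid m n" "\<gamma> \<noteq> []"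
      by (auto simp: lattice_paths_def)
    then have "hd \<gamma> \<in> grid m n" by auto
    then show "\<gamma> \<in> {\<gamma>. set \<gamma> \<subseteq> grid m n \<and> length \<gamma> \<le> m + n + 1}"
      using length_path_le[OF *] * by (auto simp: grid_def)
  qed
  show "finite {\<gamma>. set \<gamma> \<subseteq> grid m n \<and> length \<gamma> \<le> m + n + 1}"
    by (rule finite_lists_length_le) (simp add: grid_def)
qed

lemma finite_nonintersecting: "finite (nonintersecting m n k A B)"
  unfolding nonintersecting_def
  by (rule finite_subset[of _ "\<Pi>\<^sub>E i\<in>{1..k}. lattice_paths m n (A i) (B i)"])
    (auto intro!: finite_PiE simp: finite_lattice_paths)

end

theory Submission
  imports Defs "HOL-Library.Multiset"
begin

text \<open>
  The path sum is a determinant of sums over single paths, and an adjacent transposition of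
  the \<open>x\<^sub>i\<close> acts on that determinant by an elementary row operation.

  By the Lindstrom-Gessel-Viennot lemma (\<open>lindstrom_gessel_viennot\<close>) the determinant of the
  matrix whose \<open>(i, j)\<close> entry is the weight sum over all paths from \<open>(a + i, 1)\<close> to \<open>(1, b\<^sub>j)\<close>
  is the signed sum over non-intersecting systems whose endpoints may be permuted. In the plane
  two paths with exchanged endpoints must cross (\<open>lattice_paths_cross\<close>), so only the identity
  permutation contributes and the determinant is the path sum.

  Let \<open>g(p, c)\<close> be the weight sum over the paths from \<open>(p, c)\<close> to a fixed end \<open>(1, b)\<close>. Splitting
  off the first step gives \<open>(x\<^sub>p + y\<^sub>c) g(p, c) = g(p - 1, c) + g(p, c + 1)\<close>, with an additional
  summand \<open>1\<close> at the end point. If \<open>g(p, -)\<close> is read as a column vector, row \<open>p\<close> arises from row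
  \<open>p - 1\<close> by the operator \<open>M(x\<^sub>p)\<close>, where \<open>M(x) = (x + D)\<^sup>-\<^sup>1\<close> with \<open>D\<close> bidiagonal and independent
  of \<open>x\<close>. The \<open>M(x)\<close> are resolvents of one operator: they commute, and
  \<open>M(x') - M(x) = (x - x') M(x') M(x)\<close>. Hence exchanging \<open>x\<^sub>s\<close> and \<open>x\<^bsub>s+1\<^esub>\<close> leaves every row
  except row \<open>s\<close> unchanged (\<open>one_path_sum_swap_invariant\<close>) and adds to row \<open>s\<close> the multiple
  \<open>x\<^sub>s - x\<^bsub>s+1\<^esub>\<close> of row \<open>s + 1\<close> (\<open>one_path_sum_swap_row\<close>).

  The determinant uses the rows \<open>a + 1, \<dots>, m\<close>. As they reach down to the last row \<open>m\<close>, whenever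
  row \<open>s < m\<close> is among them so is row \<open>s + 1\<close>, and the determinant does not change. Adjacent
  transpositions generate all permutations. The argument works over any field in which no
  \<open>x\<^sub>i + y\<^sub>j\<close> vanishes, and is then applied to the field of rational functions.
\<close>

section \<open>Sign-reversing involutions and Leibniz sums\<close>

text \<open>
  The colouring \<open>P\<close> is exchanged by the involution, so the sum over one colour is the negative of
  the sum over the other. Arguing from \<open>2 S = 0\<close> would fail in characteristic 2.
\<close>

lemma sum_sign_reversing_eq_0:
  fixes f :: "'a \<Rightarrow> 'b::ab_group_add"
  assumes "finite S"
    and closed: "\<And>x. x \<in> S \<Longrightarrow> \<phi> x \<in> S"
    and invol: "\<And>x. x \<in> S \<Longrightarrow> \<phi> (\<phi> x) = x"
    and colour: "\<And>x. x \<in> S \<Longrightarrow> P (\<phi> x) \<longleftrightarrow> \<not> P x"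
    and neg: "\<And>x. x \<in> S \<Longrightarrow> f (\<phi> x) = - f x"
  shows "sum f S = 0"
proof -
  have "sum f S = sum f {x \<in> S. P x} + sum f {x \<in> S. \<not> P x}"
    using assms(1) by (subst sum.union_disjoint[symmetric]) (auto intro!: sum.cong)
  also have "sum f {x \<in> S. \<not> P x} = (\<Sum>x\<in>{x \<in> S. P x}. - f x)"
    by (rule sum.reindex_bij_witness[of _ \<phi> \<phi>]) (auto simp: closed invol colour neg)
  finally show ?thesis
    by (simp add: sum_negf)
qed

definition leibniz_det :: "'i set \<Rightarrow> ('i \<Rightarrow> 'i \<Rightarrow> 'a) \<Rightarrow> 'a::comm_ring_1"
  where "leibniz_det I f = (\<Sum>\<sigma> | \<sigma> permutes I. of_int (sign \<sigma>) * (\<Prod>i\<in>I. f i (\<sigma> i)))"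

lemma sign_compose_transpose:
  assumes "finite I" "\<sigma> permutes I" "i \<noteq> j"
  shows "sign (\<sigma> \<circ> transpose i j) = - sign \<sigma>"
  using assms permutation_permutes[of \<sigma>]
  by (subst sign_compose) (auto simp: sign_swap_id permutation_swap_id)

lemma leibniz_det_cong:
  assumes "\<And>i j. i \<in> I \<Longrightarrow> j \<in> I \<Longrightarrow> f i j = g i j"
  shows "leibniz_det I f = leibniz_det I g"
  unfolding leibniz_det_def
  by (intro sum.cong refl arg_cong2[where f = "(*)"] prod.cong) (auto simp: assms permutes_in_image)

text \<open>
  Composing a permutation with the transposition of the two rows reverses the sign and keeps the
  product.
\<close>

lemma leibniz_det_equal_rows:
  fixes f :: "'i \<Rightarrow> 'i \<Rightarrow> 'a::comm_ring_1"
  assumes I: "finite I" and ij: "i \<in> I" "j \<in> I" "i \<noteq> j" and eq: "f i = f j"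
  shows "leibniz_det I f = 0"
  unfolding leibniz_det_def
proof (rule sum_sign_reversing_eq_0[where \<phi> = "\<lambda>\<sigma>. \<sigma> \<circ> transpose i j" and P = "\<lambda>\<sigma>. sign \<sigma> = 1"])
  show "finite {\<sigma>. \<sigma> permutes I}"
    using I by (rule finite_permutations)
next
  fix \<sigma> assume "\<sigma> \<in> {\<sigma>. \<sigma> permutes I}"
  then have \<sigma>: "\<sigma> permutes I" by simp
  have t: "transpose i j permutes I"
    using ij by (simp add: permutes_swap_id)
  show "\<sigma> \<circ> transpose i j \<in> {\<sigma>. \<sigma> permutes I}"
    using permutes_compose[OF t \<sigma>] by simp
  show "\<sigma> \<circ> transpose i j \<circ> transpose i j = \<sigma>"
    by (simp add: comp_assoc)
  have sgn: "sign (\<sigma> \<circ> transpose i j) = - sign \<sigma>"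
    by (rule sign_compose_transpose[OF I \<sigma> ij(3)])
  then show "sign (\<sigma> \<circ> transpose i j) = 1 \<longleftrightarrow> \<not> sign \<sigma> = 1"
    by (simp add: sign_def split: if_splits)
  have "(\<Prod>l\<in>I. f l ((\<sigma> \<circ> transpose i j) l)) = (\<Prod>l\<in>I. f (transpose i j l) (\<sigma> l))"
    by (rule prod.reindex_bij_witness[of _ "transpose i j" "transpose i j"])
      (use t in \<open>auto simp: permutes_in_image\<close>)
  also have "\<dots> = (\<Prod>l\<in>I. f l (\<sigma> l))"
    using eq by (intro prod.cong refl) (auto simp: transpose_def)
  finally show "of_int (sign (\<sigma> \<circ> transpose i j)) * (\<Prod>l\<in>I. f l ((\<sigma> \<circ> transpose i j) l)) =
      - (of_int (sign \<sigma>) * (\<Prod>l\<in>I. f l (\<sigma> l)))"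
    by (simp add: sgn)
qed

lemma leibniz_det_add_row:
  fixes f :: "'i \<Rightarrow> 'i \<Rightarrow> 'a::comm_ring_1"
  assumes I: "finite I" and ij: "i \<in> I" "j \<in> I" "i \<noteq> j"
  shows "leibniz_det I (f(i := \<lambda>l. f i l + c * f j l)) = leibniz_det I f"
proof -
  have upd: "(\<Prod>l\<in>I. (f(i := g)) l (\<sigma> l)) = g (\<sigma> i) * (\<Prod>l\<in>I - {i}. f l (\<sigma> l))" for g \<sigma>
    using I ij(1) by (subst prod.remove[of _ i]) auto
  have "leibniz_det I (f(i := \<lambda>l. f i l + c * f j l)) =
      leibniz_det I (f(i := f i)) + c * leibniz_det I (f(i := f j))"
    unfolding leibniz_det_def upd
    by (simp add: algebra_simps sum.distrib sum_distrib_left)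
  also have "leibniz_det I (f(i := f j)) = 0"
    using I ij by (intro leibniz_det_equal_rows[of I i j]) auto
  finally show ?thesis
    by (simp only: fun_upd_triv mult_zero_right add_0_right)
qed

section \<open>Non-intersecting paths and determinants\<close>

text \<open>
  Both kinds of steps increase column minus row, so a path never returns to a point.
\<close>

lemma lattice_path_distinct:
  assumes "\<gamma> \<in> lattice_paths m n A B"
  shows "distinct \<gamma>"
proof -
  let ?h = "\<lambda>P :: point. int (snd P) - int (fst P)"
  have "successively (\<lambda>P Q. ?h P < ?h Q) \<gamma>"
    by (rule successively_mono[where P = step])
      (use assms in \<open>auto simp: lattice_paths_def step_def\<close>)
  then have "sorted_wrt (\<lambda>P Q. ?h P < ?h Q) \<gamma>"
    by (subst (asm) successively_conv_sorted_wrt) (auto simp: transp_def)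
  then have "sorted_wrt (<) (map ?h \<gamma>)"
    by (simp add: sorted_wrt_map)
  then have "distinct (map ?h \<gamma>)"
    using strict_sorted_iff by blast
  then show ?thesis
    by (simp add: distinct_map)
qed

text \<open>
  The switched path follows \<open>\<gamma>\<close> up to \<open>v\<close> and continues along \<open>\<delta>\<close>; the point \<open>v\<close> itself comes
  from \<open>\<delta>\<close>. It is meant for a common point \<open>v\<close> of the two paths.
\<close>

definition switch :: "'a \<Rightarrow> 'a list \<Rightarrow> 'a list \<Rightarrow> 'a list"
  where "switch v \<gamma> \<delta> = takeWhile (\<lambda>p. p \<noteq> v) \<gamma> @ dropWhile (\<lambda>p. p \<noteq> v) \<delta>"

lemma dropWhile_neq_Cons:
  assumes "v \<in> set \<delta>"
  shows "dropWhile (\<lambda>p. p \<noteq> v) \<delta> = v # tl (dropWhile (\<lambda>p. p \<noteq> v) \<delta>)"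
  using assms by (induction \<delta>) auto

lemma takeWhile_switch:
  assumes "v \<in> set \<delta>"
  shows "takeWhile (\<lambda>p. p \<noteq> v) (switch v \<gamma> \<delta>) = takeWhile (\<lambda>p. p \<noteq> v) \<gamma>"
  unfolding switch_def
  by (subst dropWhile_neq_Cons[OF assms], subst takeWhile_append2) (auto dest: set_takeWhileD)

lemma dropWhile_switch:
  "dropWhile (\<lambda>p. p \<noteq> v) (switch v \<gamma> \<delta>) = dropWhile (\<lambda>p. p \<noteq> v) \<delta>"
  by (auto simp: switch_def dropWhile_append dest: set_takeWhileD)

lemma switch_switch:
  assumes "v \<in> set \<gamma>" "v \<in> set \<delta>"
  shows "switch v (switch v \<gamma> \<delta>) (switch v \<delta> \<gamma>) = \<gamma>"
proof -
  have "switch v (switch v \<gamma> \<delta>) (switch v \<delta> \<gamma>) =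
      takeWhile (\<lambda>p. p \<noteq> v) (switch v \<gamma> \<delta>) @ dropWhile (\<lambda>p. p \<noteq> v) (switch v \<delta> \<gamma>)"
    by (simp only: switch_def[of v "switch v \<gamma> \<delta>"])
  then show ?thesis
    using assms by (simp add: takeWhile_switch dropWhile_switch)
qed

lemma mset_switch: "mset (switch v \<gamma> \<delta>) + mset (switch v \<delta> \<gamma>) = mset \<gamma> + mset \<delta>"
proof -
  have "mset \<gamma> = mset (takeWhile (\<lambda>p. p \<noteq> v) \<gamma>) + mset (dropWhile (\<lambda>p. p \<noteq> v) \<gamma>)" for \<gamma>
    by (metis mset_append takeWhile_dropWhile_id)
  from this[of \<gamma>] this[of \<delta>] show ?thesis
    by (simp add: switch_def)
qed

lemma mem_switch: "v \<in> set \<delta> \<Longrightarrow> v \<in> set (switch v \<gamma> \<delta>)"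
  by (subst switch_def, subst dropWhile_neq_Cons) auto

lemma switch_lattice_paths:
  assumes g: "\<gamma> \<in> lattice_paths m n A B" and d: "\<delta> \<in> lattice_paths m n A' B'"
    and v: "v \<in> set \<gamma>" "v \<in> set \<delta>"
  shows "switch v \<gamma> \<delta> \<in> lattice_paths m n A B'"
proof -
  let ?t = "takeWhile (\<lambda>p. p \<noteq> v)" and ?d = "\<lambda>\<delta>. tl (dropWhile (\<lambda>p. p \<noteq> v) \<delta>)"
  have split: "\<gamma> = ?t \<gamma> @ v # ?d \<gamma>" if "v \<in> set \<gamma>" for \<gamma>
    using dropWhile_neq_Cons[OF that] by (metis takeWhile_dropWhile_id)
  obtain u w where \<gamma>: "\<gamma> = u @ v # w" "?t \<gamma> = u"
    using split[OF v(1)] by blast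
  obtain u' w' where \<delta>: "\<delta> = u' @ v # w'" "?d \<delta> = w'"
    using split[OF v(2)] by blast
  have "switch v \<gamma> \<delta> = u @ v # w'"
    unfolding switch_def by (subst dropWhile_neq_Cons[OF v(2)]) (simp only: \<gamma>(2) \<delta>(2))
  then show ?thesis
    using g d unfolding \<gamma>(1) \<delta>(1) lattice_paths_def
    by (auto simp: successively_append_iff hd_append successively_Cons split: if_splits)
qed

text \<open>
  The multiset of all visited points therefore detects intersections: the paths meet if and only
  if some multiplicity is at least 2.
\<close>

lemma count_sum_mset_distinct:
  assumes "finite I" "\<And>i. i \<in> I \<Longrightarrow> distinct (\<Upsilon> i)"
  shows "count (\<Sum>i\<in>I. mset (\<Upsilon> i)) p = card {i \<in> I. p \<in> set (\<Upsilon> i)}"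
proof -
  have "count (\<Sum>i\<in>I. mset (\<Upsilon> i)) p = (\<Sum>i\<in>I. if p \<in> set (\<Upsilon> i) then 1 else 0)"
    unfolding count_sum using assms(2) by (intro sum.cong) (auto simp: distinct_count_atmost_1)
  also have "\<dots> = card {i \<in> I. p \<in> set (\<Upsilon> i)}"
    using assms(1) by (subst sum.If_cases) (auto intro!: arg_cong[where f = card])
  finally show ?thesis .
qed

lemma prod_path_weights_eq_prod_mset:
  fixes wt :: "'p \<Rightarrow> 'a::comm_monoid_mult"
  assumes "finite I" "\<And>i. i \<in> I \<Longrightarrow> distinct (\<Upsilon> i)"
  shows "(\<Prod>i\<in>I. \<Prod>p\<in>set (\<Upsilon> i). wt p) = prod_mset (image_mset wt (\<Sum>i\<in>I. mset (\<Upsilon> i)))"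
  using assms
proof (induction I rule: finite_induct)
  case (insert i I)
  have "(\<Prod>p\<in>set (\<Upsilon> i). wt p) = prod_mset (image_mset wt (mset (\<Upsilon> i)))"
    using insert.prems by (simp add: prod.distinct_set_conv_list prod_mset_prod_list flip: mset_map)
  then show ?case
    using insert by simp
qed simp

definition first_two_paths_through :: "'i::linorder set \<Rightarrow> 'p \<Rightarrow> ('i \<Rightarrow> 'p list) \<Rightarrow> 'i \<times> 'i"
  where "first_two_paths_through I v \<Upsilon> = (let J = {i \<in> I. v \<in> set (\<Upsilon> i)} in (Min J, Min (J - {Min J})))"

text \<open>
  The point \<open>v\<close> is chosen as a function of the multiset of visited points alone. As swapping
  tails preserves this multiset, and also the set of paths through \<open>v\<close>, the second
  application makes the same choices as the first one.
\<close>

definition tail_swap :: "'i::linorder set \<Rightarrow> ('i \<Rightarrow> 'i) \<times> ('i \<Rightarrow> 'p list) \<Rightarrow> ('i \<Rightarrow> 'i) \<times> ('i \<Rightarrow> 'p list)"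
  where "tail_swap I = (\<lambda>(\<sigma>, \<Upsilon>).
    let v = (SOME v. count (\<Sum>i\<in>I. mset (\<Upsilon> i)) v \<ge> 2); (i, j) = first_two_paths_through I v \<Upsilon>
    in (\<sigma> \<circ> transpose i j, \<Upsilon>(i := switch v (\<Upsilon> i) (\<Upsilon> j), j := switch v (\<Upsilon> j) (\<Upsilon> i))))"

definition path_systems ::
    "nat \<Rightarrow> nat \<Rightarrow> 'i set \<Rightarrow> ('i \<Rightarrow> point) \<Rightarrow> ('i \<Rightarrow> point) \<Rightarrow> (('i \<Rightarrow> 'i) \<times> ('i \<Rightarrow> point list)) set"
  where "path_systems m n I A B =
    (SIGMA \<sigma>:{\<sigma>. \<sigma> permutes I}. \<Pi>\<^sub>E i\<in>I. lattice_paths m n (A i) (B (\<sigma> i)))"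

lemma finite_path_systems: "finite I \<Longrightarrow> finite (path_systems m n I A B)"
  unfolding path_systems_def
  by (intro finite_SigmaI finite_PiE) (auto simp: finite_permutations finite_lattice_paths)

text \<open>
  On intersecting systems \<open>tail_swap\<close> is a sign-reversing involution that preserves the visited
  points with multiplicity, and hence the weight.
\<close>

lemma tail_swap:
  fixes A B :: "'i::linorder \<Rightarrow> point"
  assumes I: "finite I" and mem: "(\<sigma>, \<Upsilon>) \<in> path_systems m n I A B"
    and meet: "\<not> disjoint_family_on (\<lambda>i. set (\<Upsilon> i)) I"
    and swap: "tail_swap I (\<sigma>, \<Upsilon>) = (\<sigma>', \<Upsilon>')"
  shows "(\<sigma>', \<Upsilon>') \<in> path_systems m n I A B"
    and "(\<Sum>i\<in>I. mset (\<Upsilon>' i)) = (\<Sum>i\<in>I. mset (\<Upsilon> i))"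
    and "\<not> disjoint_family_on (\<lambda>i. set (\<Upsilon>' i)) I"
    and "sign \<sigma>' = - sign \<sigma>"
    and "tail_swap I (\<sigma>', \<Upsilon>') = (\<sigma>, \<Upsilon>)"
proof -
  define v where "v = (SOME v. count (\<Sum>i\<in>I. mset (\<Upsilon> i)) v \<ge> 2)"
  define J where "J = {i \<in> I. v \<in> set (\<Upsilon> i)}"
  define i where "i = Min J"
  define j where "j = Min (J - {i})"
  have \<sigma>: "\<sigma> permutes I" and \<Upsilon>: "\<Upsilon> \<in> (\<Pi>\<^sub>E i\<in>I. lattice_paths m n (A i) (B (\<sigma> i)))"
    using mem by (auto simp: path_systems_def)
  have path: "\<Upsilon> l \<in> lattice_paths m n (A l) (B (\<sigma> l))" if "l \<in> I" for l
    using \<Upsilon> that by auto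
  have dist: "distinct (\<Upsilon> l)" if "l \<in> I" for l
    using path[OF that] by (rule lattice_path_distinct)
  obtain p i0 j0 where p: "i0 \<in> I" "j0 \<in> I" "i0 \<noteq> j0" "p \<in> set (\<Upsilon> i0)" "p \<in> set (\<Upsilon> j0)"
    using meet by (auto simp: disjoint_family_on_def)
  have "card {i0, j0} \<le> card {l \<in> I. p \<in> set (\<Upsilon> l)}"
    using p I by (intro card_mono) auto
  then have "count (\<Sum>i\<in>I. mset (\<Upsilon> i)) p \<ge> 2"
    using p(3) by (simp add: count_sum_mset_distinct[OF I dist])
  then have v2: "count (\<Sum>i\<in>I. mset (\<Upsilon> i)) v \<ge> 2"
    unfolding v_def by (rule someI)
  then have J2: "card J \<ge> 2"
    by (simp add: count_sum_mset_distinct[OF I dist] J_def)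
  have finJ: "finite J"
    using I by (simp add: J_def)
  have "J \<noteq> {}" "J - {i} \<noteq> {}"
    using J2 card_mono[of "{i}" J] by auto
  then have "i \<in> J" "j \<in> J - {i}"
    using finJ by (auto simp only: i_def j_def intro!: Min_in)
  then have ij: "i \<in> I" "j \<in> I" "i \<noteq> j" "v \<in> set (\<Upsilon> i)" "v \<in> set (\<Upsilon> j)"
    by (auto simp: J_def)
  have "first_two_paths_through I v \<Upsilon> = (i, j)"
    by (simp add: first_two_paths_through_def J_def i_def j_def Let_def)
  then have \<sigma>': "\<sigma>' = \<sigma> \<circ> transpose i j"
    and \<Upsilon>': "\<Upsilon>' = \<Upsilon>(i := switch v (\<Upsilon> i) (\<Upsilon> j), j := switch v (\<Upsilon> j) (\<Upsilon> i))"
    using swap by (simp_all add: tail_swap_def v_def[symmetric] Let_def)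
  have \<Upsilon>'i: "\<Upsilon>' i = switch v (\<Upsilon> i) (\<Upsilon> j)" and \<Upsilon>'j: "\<Upsilon>' j = switch v (\<Upsilon> j) (\<Upsilon> i)"
    using ij(3) by (simp_all add: \<Upsilon>')
  have t: "transpose i j permutes I"
    using ij by (simp add: permutes_swap_id)
  have path': "\<Upsilon>' l \<in> lattice_paths m n (A l) (B (\<sigma>' l))" if "l \<in> I" for l
    using that path switch_lattice_paths[OF path[OF ij(1)] path[OF ij(2)] ij(4,5)]
      switch_lattice_paths[OF path[OF ij(2)] path[OF ij(1)] ij(5,4)]
    by (auto simp: \<Upsilon>' \<sigma>' transpose_def)
  show mem': "(\<sigma>', \<Upsilon>') \<in> path_systems m n I A B"
    using permutes_compose[OF t \<sigma>] path' \<Upsilon> ij by (auto simp: path_systems_def \<sigma>' \<Upsilon>' PiE_def extensional_def)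
  have dist': "distinct (\<Upsilon>' l)" if "l \<in> I" for l
    using path'[OF that] by (rule lattice_path_distinct)
  have split: "(\<Sum>l\<in>I. mset (\<Phi> l)) = mset (\<Phi> i) + mset (\<Phi> j) + (\<Sum>l\<in>I - {i} - {j}. mset (\<Phi> l))"
    for \<Phi> :: "'i \<Rightarrow> point list"
    using I ij by (subst sum.remove[of _ i], simp, simp, subst sum.remove[of _ j]) auto
  have rest: "(\<Sum>l\<in>I - {i} - {j}. mset (\<Upsilon>' l)) = (\<Sum>l\<in>I - {i} - {j}. mset (\<Upsilon> l))"
    by (rule sum.cong) (auto simp: \<Upsilon>')
  show visits: "(\<Sum>i\<in>I. mset (\<Upsilon>' i)) = (\<Sum>i\<in>I. mset (\<Upsilon> i))"
    unfolding split[of \<Upsilon>'] split[of \<Upsilon>] rest by (simp only: \<Upsilon>'i \<Upsilon>'j mset_switch)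
  have vi: "v \<in> set (\<Upsilon>' i)" and vj: "v \<in> set (\<Upsilon>' j)"
    using ij(4,5) by (simp_all add: \<Upsilon>'i \<Upsilon>'j mem_switch)
  then show "\<not> disjoint_family_on (\<lambda>i. set (\<Upsilon>' i)) I"
    using ij(1-3) by (auto simp: disjoint_family_on_def)
  show "sign \<sigma>' = - sign \<sigma>"
    unfolding \<sigma>' by (rule sign_compose_transpose[OF I \<sigma> ij(3)])
  have v': "(SOME v. count (\<Sum>i\<in>I. mset (\<Upsilon>' i)) v \<ge> 2) = v"
    unfolding visits by (simp add: v_def)
  have "{l \<in> I. v \<in> set (\<Upsilon>' l)} = J"
    using ij(4,5) vi vj unfolding J_def by (auto simp: \<Upsilon>' split: if_splits)
  then have "first_two_paths_through I v \<Upsilon>' = (i, j)"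
    by (simp add: first_two_paths_through_def i_def j_def Let_def)
  then have "tail_swap I (\<sigma>', \<Upsilon>') =
      (\<sigma>' \<circ> transpose i j, \<Upsilon>'(i := switch v (\<Upsilon>' i) (\<Upsilon>' j), j := switch v (\<Upsilon>' j) (\<Upsilon>' i)))"
    by (simp add: tail_swap_def v' Let_def)
  also have "\<dots> = (\<sigma>, \<Upsilon>)"
    unfolding \<Upsilon>'i \<Upsilon>'j switch_switch[OF ij(4,5)] switch_switch[OF ij(5,4)]
    by (auto simp: \<sigma>' \<Upsilon>' comp_assoc fun_eq_iff)
  finally show "tail_swap I (\<sigma>', \<Upsilon>') = (\<sigma>, \<Upsilon>)" .
qed

text \<open>
  Expanding the determinant gives the signed sum over all path systems; the intersecting ones
  cancel in pairs under \<open>tail_swap\<close>.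
\<close>

theorem lindstrom_gessel_viennot:
  fixes A B :: "'i::linorder \<Rightarrow> point" and wt :: "point \<Rightarrow> 'a::comm_ring_1"
  assumes I: "finite I"
  shows "leibniz_det I (\<lambda>i j. \<Sum>\<gamma>\<in>lattice_paths m n (A i) (B j). \<Prod>p\<in>set \<gamma>. wt p) =
    (\<Sum>(\<sigma>, \<Upsilon>) | (\<sigma>, \<Upsilon>) \<in> path_systems m n I A B \<and> disjoint_family_on (\<lambda>i. set (\<Upsilon> i)) I.
      of_int (sign \<sigma>) * (\<Prod>i\<in>I. \<Prod>p\<in>set (\<Upsilon> i). wt p))"
proof -
  define S where "S = path_systems m n I A B"
  define D where "D = (\<lambda>(\<sigma> :: 'i \<Rightarrow> 'i, \<Upsilon> :: 'i \<Rightarrow> point list). disjoint_family_on (\<lambda>i. set (\<Upsilon> i)) I)"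
  define f :: "('i \<Rightarrow> 'i) \<times> ('i \<Rightarrow> point list) \<Rightarrow> 'a"
    where "f = (\<lambda>(\<sigma>, \<Upsilon>). of_int (sign \<sigma>) * (\<Prod>i\<in>I. \<Prod>p\<in>set (\<Upsilon> i). wt p))"
  have finS: "finite S"
    unfolding S_def by (rule finite_path_systems[OF I])
  have "leibniz_det I (\<lambda>i j. \<Sum>\<gamma>\<in>lattice_paths m n (A i) (B j). \<Prod>p\<in>set \<gamma>. wt p) =
      (\<Sum>\<sigma> | \<sigma> permutes I. \<Sum>\<Upsilon>\<in>(\<Pi>\<^sub>E i\<in>I. lattice_paths m n (A i) (B (\<sigma> i))). f (\<sigma>, \<Upsilon>))"
    unfolding leibniz_det_def f_def
    by (simp add: prod_sum_PiE[OF I] finite_lattice_paths sum_distrib_left)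
  also have "\<dots> = sum f S"
    unfolding S_def path_systems_def using I
    by (subst sum.Sigma) (auto simp: finite_permutations finite_lattice_paths intro!: finite_PiE)
  also have "\<dots> = sum f {s \<in> S. D s} + sum f {s \<in> S. \<not> D s}"
    using finS by (subst sum.union_disjoint[symmetric]) (auto intro!: sum.cong)
  also have "sum f {s \<in> S. \<not> D s} = 0"
  proof (rule sum_sign_reversing_eq_0[where \<phi> = "tail_swap I" and P = "\<lambda>s. sign (fst s) = 1"])
    show "finite {s \<in> S. \<not> D s}"
      using finS by simp
  next
    fix s assume s: "s \<in> {s \<in> S. \<not> D s}"
    obtain \<sigma> \<Upsilon> \<sigma>' \<Upsilon>' where eq: "s = (\<sigma>, \<Upsilon>)" "tail_swap I (\<sigma>, \<Upsilon>) = (\<sigma>', \<Upsilon>')"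
      by (metis surj_pair)
    have mem: "(\<sigma>, \<Upsilon>) \<in> path_systems m n I A B"
      and meet: "\<not> disjoint_family_on (\<lambda>i. set (\<Upsilon> i)) I"
      using s by (auto simp: eq(1) S_def D_def)
    note ts = tail_swap[OF I mem meet eq(2)]
    show "tail_swap I s \<in> {s \<in> S. \<not> D s}"
      using ts(1,3) by (simp add: eq S_def D_def)
    show "tail_swap I (tail_swap I s) = s"
      using ts(5) by (simp add: eq)
    show "sign (fst (tail_swap I s)) = 1 \<longleftrightarrow> \<not> sign (fst s) = 1"
      using ts(4) by (simp add: eq sign_def split: if_splits)
    have dist: "distinct (\<Phi> i)" if "i \<in> I" "(\<tau>, \<Phi>) \<in> path_systems m n I A B" for i \<tau> \<Phi>
      using that by (auto simp: path_systems_def PiE_iff intro: lattice_path_distinct)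
    show "f (tail_swap I s) = - f s"
      using dist[OF _ mem] dist[OF _ ts(1)]
      by (simp add: eq f_def ts(2,4) prod_path_weights_eq_prod_mset[OF I])
  qed
  finally show ?thesis
    unfolding S_def D_def f_def by (simp add: case_prod_unfold)
qed

section \<open>Planarity fixes the endpoints\<close>

lemma lattice_path_Cons_iff:
  "P # \<gamma> \<in> lattice_paths m n A B \<longleftrightarrow>
    P = A \<and> A \<in> grid m n \<and> (if \<gamma> = [] then A = B else step A (hd \<gamma>) \<and> \<gamma> \<in> lattice_paths m n (hd \<gamma>) B)"
  by (auto simp: lattice_paths_def successively_Cons)

lemma lattice_path_column_le:
  assumes "\<gamma> \<in> lattice_paths m n A B"
  shows "snd A \<le> snd B"
  using assms
proof (induction \<gamma> arbitrary: A)
  case Nil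
  then show ?case by (simp add: lattice_paths_def)
next
  case (Cons P \<gamma>)
  show ?case
  proof (cases "\<gamma> = []")
    case True
    then show ?thesis
      using Cons.prems by (simp add: lattice_path_Cons_iff)
  next
    case False
    then have "step A (hd \<gamma>)" "snd (hd \<gamma>) \<le> snd B"
      using Cons.prems Cons.IH by (auto simp: lattice_path_Cons_iff)
    then show ?thesis
      by (auto simp: step_def)
  qed
qed

lemma lattice_path_enters_next_column:
  assumes "\<gamma> \<in> lattice_paths m n A (q, d)" "(r, c) \<in> set \<gamma>" "c < d"
  shows "\<exists>r'\<le>r. (r', Suc c) \<in> set \<gamma>"
  using assms
proof (induction \<gamma> arbitrary: A r)
  case Nil
  then show ?case by simp
next
  case (Cons P \<gamma>)
  show ?case
  proof (cases "(r, c) \<in> set \<gamma>")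
    case True
    then have "\<gamma> \<in> lattice_paths m n (hd \<gamma>) (q, d)"
      using Cons.prems(1) by (auto simp: lattice_path_Cons_iff split: if_splits)
    then show ?thesis
      using Cons.IH[OF _ True Cons.prems(3)] by (metis list.set_intros(2))
  next
    case False
    then have P: "P = (r, c)"
      using Cons.prems(2) by simp
    have ne: "\<gamma> \<noteq> []" and st: "step (r, c) (hd \<gamma>)" and \<gamma>: "\<gamma> \<in> lattice_paths m n (hd \<gamma>) (q, d)"
      using Cons.prems(1,3) by (auto simp: lattice_path_Cons_iff P split: if_splits)
    have hd: "hd \<gamma> \<in> set \<gamma>"
      using ne by simp
    from st consider r' where "r = Suc r'" "hd \<gamma> = (r', c)" | "hd \<gamma> = (r, Suc c)"
      by (cases "hd \<gamma>") (auto simp: step_def)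
    then show ?thesis
    proof cases
      case 1
      then have "\<exists>r''\<le>r'. (r'', Suc c) \<in> set \<gamma>"
        using Cons.IH[OF \<gamma>] hd Cons.prems(3) by simp
      then show ?thesis
        using 1 by (auto intro: le_SucI)
    next
      case 2
      then show ?thesis
        using hd by auto
    qed
  qed
qed

text \<open>
  If the paths were disjoint, every point of \<open>\<delta>\<close> would lie strictly below some point of \<open>\<gamma>\<close> in
  the same column. This property, which holds for the first point of \<open>\<delta>\<close> by assumption, passes
  along each step: going up, \<open>\<delta>\<close> cannot reach the point of \<open>\<gamma>\<close> above it; going right, \<open>\<gamma>\<close> also
  continues into the next column, as it ends further right than \<open>\<delta>\<close>, and never descends. But
  the end of \<open>\<delta>\<close> is in the top row, with nothing above it.
\<close>

lemma lattice_paths_cross: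
  assumes \<gamma>: "\<gamma> \<in> lattice_paths m n A (1, d)"
    and "\<delta> \<in> lattice_paths m n (q, c) (1, e)" "e < d"
    and "(p, c) \<in> set \<gamma>" "p < q"
  shows "set \<gamma> \<inter> set \<delta> \<noteq> {}"
  using assms(2-)
proof (induction \<delta> arbitrary: q c p)
  case Nil
  then show ?case by (simp add: lattice_paths_def)
next
  case (Cons Q \<delta>)
  have pos: "p \<ge> 1"
    using Cons.prems(3) \<gamma> by (auto simp: lattice_paths_def grid_def)
  have ne: "\<delta> \<noteq> []" and st: "step (q, c) (hd \<delta>)" and \<delta>: "\<delta> \<in> lattice_paths m n (hd \<delta>) (1, e)"
    using Cons.prems(1,4) pos by (auto simp: lattice_path_Cons_iff split: if_splits)
  have hd: "hd \<delta> \<in> set \<delta>"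
    using ne by simp
  from st consider "q = Suc (fst (hd \<delta>))" "snd (hd \<delta>) = c" | "hd \<delta> = (q, Suc c)"
    by (cases "hd \<delta>") (auto simp: step_def)
  then show ?case
  proof cases
    case 1
    then obtain q' where q': "q = Suc q'" "hd \<delta> = (q', c)"
      by (cases "hd \<delta>") auto
    show ?thesis
    proof (cases "p = q'")
      case True
      then show ?thesis
        using hd q' Cons.prems(3) by auto
    next
      case False
      then have "set \<gamma> \<inter> set \<delta> \<noteq> {}"
        using Cons.IH[of q' c p] Cons.prems \<delta> q' by simp
      then show ?thesis
        by auto
    qed
  next
    case 2
    have "c < e"
      using lattice_path_column_le[OF \<delta>] 2 by simp
    then obtain p' where "p' \<le> p" "(p', Suc c) \<in> set \<gamma>"
      using lattice_path_enters_next_column[OF \<gamma> Cons.prems(3)] Cons.prems(2) by auto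
    then have "set \<gamma> \<inter> set \<delta> \<noteq> {}"
      using Cons.IH[of q "Suc c" p'] Cons.prems \<delta> 2 by simp
    then show ?thesis
      by auto
  qed
qed

lemma strict_mono_on_permutes_eq_id:
  fixes \<sigma> :: "nat \<Rightarrow> nat"
  assumes \<sigma>: "\<sigma> permutes {1..k}" and mono: "strict_mono_on {1..k} \<sigma>"
  shows "\<sigma> = id"
proof (rule permutes_natset_ge[OF \<sigma>, rule_format])
  fix i assume "i \<in> {1..k}"
  then show "i \<le> \<sigma> i"
  proof (induction i)
    case (Suc i)
    show ?case
    proof (cases "i = 0")
      case True
      then show ?thesis
        using Suc.prems permutes_in_image[OF \<sigma>, of "Suc i"] by simp
    next
      case False
      then have "i \<le> \<sigma> i" "\<sigma> i < \<sigma> (Suc i)"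
        using Suc strict_mono_onD[OF mono, of i "Suc i"] by auto
      then show ?thesis
        by simp
    qed
  qed simp
qed

text \<open>
  An inversion of \<open>\<sigma>\<close> would give a path that starts above another one and ends to its right, and
  these two paths would cross.
\<close>

lemma nonintersecting_path_system_id:
  assumes mem: "(\<sigma>, \<Upsilon>) \<in> path_systems m n {1..k} (\<lambda>i. (a + i, 1)) (\<lambda>i. (1, b i))"
    and b: "strict_mono_on {1..k} b"
    and disj: "disjoint_family_on (\<lambda>i. set (\<Upsilon> i)) {1..k}"
  shows "\<sigma> = id"
proof (rule strict_mono_on_permutes_eq_id[of _ k])
  show \<sigma>: "\<sigma> permutes {1..k}"
    using mem by (simp add: path_systems_def)
  have path: "\<Upsilon> i \<in> lattice_paths m n (a + i, 1) (1, b (\<sigma> i))" if "i \<in> {1..k}" for i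
    using mem that by (auto simp: path_systems_def)
  show "strict_mono_on {1..k} \<sigma>"
  proof (rule strict_mono_onI, rule ccontr)
    fix i j assume ij: "i \<in> {1..k}" "j \<in> {1..k}" "i < j" and "\<not> \<sigma> i < \<sigma> j"
    moreover have "\<sigma> i \<noteq> \<sigma> j"
      using ij permutes_inj[OF \<sigma>] by (auto dest: injD)
    ultimately have "\<sigma> j < \<sigma> i"
      by simp
    moreover have "\<sigma> i \<in> {1..k}" "\<sigma> j \<in> {1..k}"
      using ij permutes_in_image[OF \<sigma>] by blast+
    ultimately have "b (\<sigma> j) < b (\<sigma> i)"
      using strict_mono_onD[OF b] by blast
    moreover have "(a + i, 1) \<in> set (\<Upsilon> i)"
      using path[OF ij(1)] hd_in_set[of "\<Upsilon> i"] by (simp add: lattice_paths_def)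
    ultimately have "set (\<Upsilon> i) \<inter> set (\<Upsilon> j) \<noteq> {}"
      using lattice_paths_cross[OF path[OF ij(1)] path[OF ij(2)]] ij(3) by simp
    then show False
      using disj ij by (auto simp: disjoint_family_on_def)
  qed
qed

text \<open>
  The point weight is arbitrary here, so that permuting the variables becomes a change of weight.
\<close>

definition weighted_path_sum ::
    "nat \<Rightarrow> nat \<Rightarrow> nat \<Rightarrow> (nat \<Rightarrow> point) \<Rightarrow> (nat \<Rightarrow> point) \<Rightarrow> (point \<Rightarrow> 'a::comm_ring_1) \<Rightarrow> 'a"
  where "weighted_path_sum m n k A B wt =
    (\<Sum>\<Upsilon>\<in>nonintersecting m n k A B. \<Prod>i=1..k. \<Prod>p\<in>set (\<Upsilon> i). wt p)"

lemma weighted_path_sum_eq_leibniz_det: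
  assumes b: "strict_mono_on {1..k} b"
  shows "weighted_path_sum m n k (\<lambda>i. (a + i, 1)) (\<lambda>i. (1, b i)) wt =
    leibniz_det {1..k} (\<lambda>i j. \<Sum>\<gamma>\<in>lattice_paths m n (a + i, 1) (1, b j). \<Prod>p\<in>set \<gamma>. wt p)"
proof -
  let ?A = "\<lambda>i. (a + i, 1)" and ?B = "\<lambda>i. (1, b i)"
  have "{(\<sigma>, \<Upsilon>). (\<sigma>, \<Upsilon>) \<in> path_systems m n {1..k} ?A ?B \<and> disjoint_family_on (\<lambda>i. set (\<Upsilon> i)) {1..k}}
      = Pair id ` nonintersecting m n k ?A ?B"
    using nonintersecting_path_system_id[OF _ b]
    by (fastforce simp: path_systems_def nonintersecting_def)
  then show ?thesis
    unfolding lindstrom_gessel_viennot[OF finite_atLeastAtMost, where A = ?A and B = ?B]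
    by (simp add: weighted_path_sum_def sum.reindex inj_on_def)
qed

section \<open>Sums over a single path\<close>

definition one_path_sum ::
    "nat \<Rightarrow> nat \<Rightarrow> (nat \<Rightarrow> 'a::field) \<Rightarrow> (nat \<Rightarrow> 'a) \<Rightarrow> point \<Rightarrow> point \<Rightarrow> 'a"
  where "one_path_sum m n x y P Q =
    (\<Sum>\<gamma>\<in>lattice_paths m n P Q. \<Prod>(i, j)\<in>set \<gamma>. 1 / (x i + y j))"

lemma one_path_sum_outside: "P \<notin> grid m n \<Longrightarrow> one_path_sum m n x y P Q = 0"
proof -
  assume "P \<notin> grid m n"
  then have "lattice_paths m n P Q = {}"
    using hd_in_set by (fastforce simp: lattice_paths_def)
  then show ?thesis
    by (simp add: one_path_sum_def)
qed

text \<open>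
  In the top row the upper neighbour has row index \<open>0\<close>; it lies outside the grid and contributes
  no path. This makes the equation uniform in \<open>P\<close>.
\<close>

lemma lattice_paths_first_step:
  assumes "P \<in> grid m n"
  shows "lattice_paths m n P Q = (if P = Q then {[P]} else {}) \<union>
    (#) P ` (lattice_paths m n (fst P - 1, snd P) Q \<union> lattice_paths m n (fst P, Suc (snd P)) Q)"
    (is "?L = ?R")
proof (rule set_eqI)
  fix \<gamma> :: "point list"
  show "\<gamma> \<in> ?L \<longleftrightarrow> \<gamma> \<in> ?R"
  proof (cases \<gamma>)
    case Nil
    then show ?thesis by (auto simp: lattice_paths_def)
  next
    case (Cons P' \<delta>)
    have hd: "hd \<delta> = R \<and> R \<in> grid m n" if "\<delta> \<in> lattice_paths m n R Q" for R
      using that hd_in_set[of \<delta>] by (auto simp: lattice_paths_def)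
    have st: "step P R \<longleftrightarrow> R = (fst P - 1, snd P) \<or> R = (fst P, Suc (snd P))" if "R \<in> grid m n" for R
      using that assms by (cases P; cases R) (auto simp: step_def grid_def)
    have "step P (hd \<delta>) \<and> \<delta> \<in> lattice_paths m n (hd \<delta>) Q \<longleftrightarrow>
        \<delta> \<in> lattice_paths m n (fst P - 1, snd P) Q \<union> lattice_paths m n (fst P, Suc (snd P)) Q"
      using hd st by (metis Un_iff)
    moreover have "[] \<notin> lattice_paths m n R Q" for R
      by (simp add: lattice_paths_def)
    ultimately show ?thesis
      unfolding Cons lattice_path_Cons_iff using assms by auto
  qed
qed

text \<open>
  This recursion determines row \<open>p\<close> from row \<open>p - 1\<close>, by descending induction on the column
  starting outside the grid, where the sum is \<open>0\<close>. The only dependence on \<open>x\<close> in this passage is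
  through \<open>x\<^sub>p\<close>.
\<close>

lemma one_path_sum_step:
  assumes pc: "(p, c) \<in> grid m n" and nz: "x p + y c \<noteq> 0"
  shows "(x p + y c) * one_path_sum m n x y (p, c) Q =
    (if (p, c) = Q then 1 else 0) + one_path_sum m n x y (p - 1, c) Q + one_path_sum m n x y (p, Suc c) Q"
proof -
  let ?w = "\<lambda>\<gamma>. \<Prod>(i, j)\<in>set \<gamma>. 1 / (x i + y j)"
  let ?U = "lattice_paths m n (p - 1, c) Q" and ?R = "lattice_paths m n (p, Suc c) Q"
  have hd: "hd \<gamma> = P" if "\<gamma> \<in> lattice_paths m n P Q" for \<gamma> P
    using that by (simp add: lattice_paths_def)
  have Nil: "[] \<notin> lattice_paths m n P Q'" for P Q'
    by (simp add: lattice_paths_def)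
  have w: "?w ((p, c) # \<gamma>) = 1 / (x p + y c) * ?w \<gamma>" if "\<gamma> \<in> ?U \<union> ?R" for \<gamma>
  proof -
    have "(p, c) # \<gamma> \<in> lattice_paths m n (p, c) Q"
      using that by (subst lattice_paths_first_step[OF pc]) auto
    then have "(p, c) \<notin> set \<gamma>"
      using lattice_path_distinct by fastforce
    then show ?thesis
      by simp
  qed
  have "one_path_sum m n x y (p, c) Q =
      (\<Sum>\<gamma>\<in>(if (p, c) = Q then {[(p, c)]} else {}). ?w \<gamma>) + (\<Sum>\<gamma>\<in>(#) (p, c) ` (?U \<union> ?R). ?w \<gamma>)"
    unfolding one_path_sum_def lattice_paths_first_step[OF pc, of Q] fst_conv snd_conv
    by (rule sum.union_disjoint) (auto simp: finite_lattice_paths Nil)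
  also have "(\<Sum>\<gamma>\<in>(#) (p, c) ` (?U \<union> ?R). ?w \<gamma>) = (\<Sum>\<gamma>\<in>?U \<union> ?R. 1 / (x p + y c) * ?w \<gamma>)"
    by (rule sum.reindex_cong[of "(#) (p, c)"]) (simp, simp, rule w)
  also have "\<dots> = 1 / (x p + y c) * ((\<Sum>\<gamma>\<in>?U. ?w \<gamma>) + (\<Sum>\<gamma>\<in>?R. ?w \<gamma>))"
    unfolding sum_distrib_left[symmetric]
    by (subst sum.union_disjoint) (auto simp: finite_lattice_paths dest!: hd)
  also have "(\<Sum>\<gamma>\<in>(if (p, c) = Q then {[(p, c)]} else {}). ?w \<gamma>) =
      1 / (x p + y c) * (if (p, c) = Q then 1 else 0)"
    by auto
  finally have "one_path_sum m n x y (p, c) Q =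
      1 / (x p + y c) * ((if (p, c) = Q then 1 else 0) + (one_path_sum m n x y (p - 1, c) Q
        + one_path_sum m n x y (p, Suc c) Q))"
    by (simp only: one_path_sum_def distrib_left)
  then show ?thesis
    using nz by (simp add: add.assoc)
qed

lemma downward_induct_from_bound [consumes 1, case_names outside step]:
  assumes "c \<ge> 1"
    and "\<And>c. c > n \<Longrightarrow> P c"
    and "\<And>c. 1 \<le> c \<Longrightarrow> c \<le> n \<Longrightarrow> P (Suc c) \<Longrightarrow> P c"
  shows "P (c :: nat)"
proof (cases "c \<le> n")
  case True
  then show ?thesis
    using assms by (induction rule: inc_induct) auto
qed (simp add: assms(2))

lemma one_path_sum_row_cong:
  fixes x x' y :: "nat \<Rightarrow> 'a::field"
  assumes nz: "\<And>i j. x i + y j \<noteq> 0" and p: "p \<le> m" and c: "c \<ge> 1"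
    and x: "x' p = x p"
    and prev: "\<And>c. c \<ge> 1 \<Longrightarrow> one_path_sum m n x' y (p - 1, c) Q = one_path_sum m n x y (p - 1, c) Q"
  shows "one_path_sum m n x' y (p, c) Q = one_path_sum m n x y (p, c) Q"
proof (cases "p = 0")
  case True
  then show ?thesis
    by (simp add: one_path_sum_outside grid_def)
next
  case False
  show ?thesis
    using c
  proof (induction rule: downward_induct_from_bound[where n = n])
    case (outside c)
    then show ?case
      by (simp add: one_path_sum_outside grid_def)
  next
    case (step c)
    have pc: "(p, c) \<in> grid m n"
      using False p step by (simp add: grid_def)
    have "(x p + y c) * one_path_sum m n x' y (p, c) Q = (x p + y c) * one_path_sum m n x y (p, c) Q"
      using one_path_sum_step[OF pc, of x' y Q] one_path_sum_step[OF pc, of x y Q] nz[of p c] step x prev[of c]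
      by simp
    then show ?case
      using nz by simp
  qed
qed

lemma one_path_sum_cong:
  fixes x x' y :: "nat \<Rightarrow> 'a::field"
  assumes nz: "\<And>i j. x i + y j \<noteq> 0" and "p \<le> m" "c \<ge> 1" and x: "\<And>i. i \<le> p \<Longrightarrow> x' i = x i"
  shows "one_path_sum m n x' y (p, c) Q = one_path_sum m n x y (p, c) Q"
  using assms(2-)
proof (induction p arbitrary: c)
  case 0
  then show ?case
    by (simp add: one_path_sum_outside grid_def)
next
  case (Suc p)
  show ?case
    by (rule one_path_sum_row_cong[OF nz]) (use Suc in auto)
qed

text \<open>
  This is the resolvent identity \<open>M(x') v - M(x) v = (x - x') M(x') M(x) v\<close> for \<open>x = x\<^sub>s\<close>,
  \<open>x' = x\<^bsub>s+1\<^esub>\<close>, where the vector \<open>v\<close> is determined by row \<open>s - 1\<close>. Both sides satisfy the same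
  one-step recursion in the column with factor \<open>x\<^bsub>s+1\<^esub> + y\<^sub>c\<close>.
\<close>

lemma one_path_sum_swap_row:
  fixes x y :: "nat \<Rightarrow> 'a::field"
  assumes nz: "\<And>i j. x i + y j \<noteq> 0" and s: "1 \<le> s" "s < m" and c: "c \<ge> 1"
  shows "one_path_sum m n (x \<circ> transpose s (Suc s)) y (s, c) (1, b) =
    one_path_sum m n x y (s, c) (1, b) + (x s - x (Suc s)) * one_path_sum m n x y (Suc s, c) (1, b)"
  using c
proof (induction rule: downward_induct_from_bound[where n = n])
  case (outside c)
  then show ?case
    by (simp add: one_path_sum_outside grid_def)
next
  case (step c)
  define x' where "x' = x \<circ> transpose s (Suc s)"
  define g where "g = (\<lambda>p c. one_path_sum m n x y (p, c) (1, b))"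
  define g' where "g' = (\<lambda>p c. one_path_sum m n x' y (p, c) (1, b))"
  have x's: "x' s = x (Suc s)"
    by (simp add: x'_def)
  have nz': "x' i + y j \<noteq> 0" for i j
    using nz by (simp add: x'_def)
  have sc: "(s, c) \<in> grid m n" "(Suc s, c) \<in> grid m n"
    using s step by (auto simp: grid_def)
  have prev: "g' (s - 1) c = g (s - 1) c"
    unfolding g_def g'_def by (rule one_path_sum_cong[OF nz])
      (use s step in \<open>auto simp: x'_def transpose_def\<close>)
  \<comment> \<open>The inhomogeneous part of the recursion for row \<open>s\<close>, the same before and after the swap.\<close>
  define v where "v = (if s = 1 \<and> c = b then 1 else 0) + g (s - 1) c"
  have e1: "(x (Suc s) + y c) * g' s c = v + g' s (Suc c)"
    using one_path_sum_step[where x = x' and y = y, OF sc(1) nz', where Q = "(1, b)"] x's prev by (simp add: g_def g'_def v_def)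
  have e2: "(x s + y c) * g s c = v + g s (Suc c)"
    using one_path_sum_step[where x = x and y = y, OF sc(1) nz, where Q = "(1, b)"] by (simp add: g_def v_def)
  have e3: "(x (Suc s) + y c) * g (Suc s) c = g s c + g (Suc s) (Suc c)"
    using one_path_sum_step[where x = x and y = y, OF sc(2) nz, where Q = "(1, b)"] s by (simp add: g_def)
  have IH: "g' s (Suc c) = g s (Suc c) + (x s - x (Suc s)) * g (Suc s) (Suc c)"
    using step(3) by (simp only: g_def g'_def x'_def)
  \<comment> \<open>Writing \<open>x\<^bsub>s+1\<^esub> + y\<^sub>c = (x\<^sub>s + y\<^sub>c) - (x\<^sub>s - x\<^bsub>s+1\<^esub>)\<close> makes the terms \<open>(x\<^sub>s - x\<^bsub>s+1\<^esub>) g(s, c)\<close> cancel.\<close>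
  have "(x (Suc s) + y c) * (g s c + (x s - x (Suc s)) * g (Suc s) c) =
      (x s + y c) * g s c - (x s - x (Suc s)) * g s c
        + (x s - x (Suc s)) * ((x (Suc s) + y c) * g (Suc s) c)"
    by (simp add: algebra_simps)
  also have "\<dots> = (x (Suc s) + y c) * g' s c"
    unfolding e1 e2 e3 IH by (simp add: algebra_simps)
  finally have "g s c + (x s - x (Suc s)) * g (Suc s) c = g' s c"
    using nz by simp
  then show ?case
    unfolding g_def g'_def x'_def by (rule sym)
qed

text \<open>
  Rows above row \<open>s\<close> do not involve the two variables, and invariance of row \<open>s + 1\<close> propagates to
  all rows below it. For row \<open>s + 1\<close> itself, the previous lemma expresses
  \<open>(x\<^sub>s - x\<^bsub>s+1\<^esub>) g(s + 1, c)\<close> as a difference of two sums that the swap exchanges. The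
  difference and \<open>x\<^sub>s - x\<^bsub>s+1\<^esub>\<close> both change sign, so \<open>g(s + 1, c)\<close> does not change, provided
  the two variables differ; if they are equal the swap does nothing.
\<close>

lemma one_path_sum_swap_invariant:
  fixes x y :: "nat \<Rightarrow> 'a::field"
  assumes nz: "\<And>i j. x i + y j \<noteq> 0" and s: "1 \<le> s" "s < m" and "p \<le> m" "c \<ge> 1" "p \<noteq> s"
  shows "one_path_sum m n (x \<circ> transpose s (Suc s)) y (p, c) (1, b) = one_path_sum m n x y (p, c) (1, b)"
proof (cases "p < s")
  case True
  show ?thesis
    by (rule one_path_sum_cong[OF nz]) (use assms True in \<open>auto simp: transpose_def\<close>)
next
  case False
  define x' where "x' = x \<circ> transpose s (Suc s)"
  have nz': "x' i + y j \<noteq> 0" for i j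
    using nz by (simp add: x'_def)
  have "Suc s \<le> p"
    using False assms by simp
  then show ?thesis
    unfolding x'_def[symmetric] using assms(4,5)
  proof (induction p arbitrary: c rule: dec_induct)
    case base
    show ?case
    proof (cases "x s = x (Suc s)")
      case True
      then have "x' = x"
        by (auto simp: x'_def fun_eq_iff transpose_def)
      then show ?thesis
        by simp
    next
      case False
      have inv: "x' \<circ> transpose s (Suc s) = x" and v: "x' s = x (Suc s)" "x' (Suc s) = x s"
        by (simp_all add: x'_def comp_assoc)
      have "(x s - x (Suc s)) * one_path_sum m n x y (Suc s, c) (1, b) =
          one_path_sum m n x' y (s, c) (1, b) - one_path_sum m n x y (s, c) (1, b)"
        using one_path_sum_swap_row[where x = x and y = y and n = n and b = b, OF nz s base(2)]
        unfolding x'_def[symmetric] by (simp add: algebra_simps)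
      moreover have "(x s - x (Suc s)) * one_path_sum m n x' y (Suc s, c) (1, b) =
          one_path_sum m n x' y (s, c) (1, b) - one_path_sum m n x y (s, c) (1, b)"
        using one_path_sum_swap_row[where x = x' and y = y and n = n and b = b, OF nz' s base(2)]
        unfolding inv v by (simp add: algebra_simps)
      ultimately have "(x s - x (Suc s)) * one_path_sum m n x' y (Suc s, c) (1, b) =
          (x s - x (Suc s)) * one_path_sum m n x y (Suc s, c) (1, b)"
        by (simp only:)
      then show ?thesis
        using False by simp
    qed
  next
    case (step p)
    show ?case
      by (rule one_path_sum_row_cong[OF nz]) (use step in \<open>auto simp: x'_def transpose_def\<close>)
  qed
qed

section \<open>Symmetry over an arbitrary field\<close>

text \<open>
  For \<open>s \<le> a\<close> the determinant has no row \<open>s\<close> and nothing changes; otherwise a multiple of the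
  next row is added to row \<open>s\<close>.
\<close>

lemma leibniz_det_one_path_sum_swap:
  fixes x y :: "nat \<Rightarrow> 'a::field"
  assumes nz: "\<And>i j. x i + y j \<noteq> 0" and s: "1 \<le> s" "s < a + k"
  shows "leibniz_det {1..k} (\<lambda>i j. one_path_sum (a + k) n (x \<circ> transpose s (Suc s)) y (a + i, 1) (1, b j)) =
    leibniz_det {1..k} (\<lambda>i j. one_path_sum (a + k) n x y (a + i, 1) (1, b j))"
    (is "leibniz_det _ ?f' = leibniz_det _ ?f")
proof (cases "s \<le> a")
  case True
  show ?thesis
    by (rule leibniz_det_cong, rule one_path_sum_swap_invariant[OF nz s]) (use True in auto)
next
  case False
  define i where "i = s - a"
  have i: "i \<in> {1..k}" "Suc i \<in> {1..k}" "s = a + i"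
    using False s by (auto simp: i_def)
  have "leibniz_det {1..k} ?f' =
      leibniz_det {1..k} (?f(i := \<lambda>l. ?f i l + (x s - x (Suc s)) * ?f (Suc i) l))"
  proof (rule leibniz_det_cong)
    fix j l assume "j \<in> {1..k}" "l \<in> {1..k}"
    then show "?f' j l = (?f(i := \<lambda>l. ?f i l + (x s - x (Suc s)) * ?f (Suc i) l)) j l"
      using one_path_sum_swap_row[where x = x and y = y and c = 1 and n = n and b = "b l", OF nz s]
        one_path_sum_swap_invariant[where x = x and y = y and p = "a + j" and c = 1 and n = n and b = "b l", OF nz s] i
      by auto
  qed
  also have "\<dots> = leibniz_det {1..k} ?f"
    using i by (intro leibniz_det_add_row) auto
  finally show ?thesis .
qed

text \<open>
  The predicate \<open>G\<close> restricts the arguments at which \<open>F\<close> is known to be symmetric; here it will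
  say that no denominator vanishes.
\<close>

lemma symmetric_of_adjacent_swaps:
  fixes F :: "(nat \<Rightarrow> 'a) \<Rightarrow> 'b"
  assumes swap: "\<And>x s. G x \<Longrightarrow> 1 \<le> s \<Longrightarrow> s < m \<Longrightarrow> F (x \<circ> transpose s (Suc s)) = F x"
    and G: "\<And>x \<pi>. G x \<Longrightarrow> G (x \<circ> \<pi>)"
    and \<pi>: "\<pi> permutes {1..m}" and x: "G x"
  shows "F (x \<circ> \<pi>) = F x"
proof -
  have shift: "F (x \<circ> transpose i (Suc (i + d))) = F x" if "G x" "1 \<le> i" "Suc (i + d) \<le> m" for i d x
    using that
  proof (induction d arbitrary: x)
    case 0
    then show ?case
      using swap[of x i] by (simp only: add_0_right Suc_le_eq)
  next
    case (Suc d)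
    \<comment> \<open>Conjugating by an adjacent transposition moves the upper index by one.\<close>
    let ?t = "transpose (Suc (i + d)) (Suc (Suc (i + d)))"
    have "transpose i (Suc (i + Suc d)) = ?t \<circ> transpose i (Suc (i + d)) \<circ> ?t"
      by (auto simp: fun_eq_iff transpose_def)
    then have "F (x \<circ> transpose i (Suc (i + Suc d))) = F (x \<circ> ?t \<circ> transpose i (Suc (i + d)) \<circ> ?t)"
      by (simp add: comp_assoc)
    also have "\<dots> = F (x \<circ> ?t \<circ> transpose i (Suc (i + d)))"
      using Suc.prems by (intro swap G) auto
    also have "\<dots> = F (x \<circ> ?t)"
      using Suc.prems by (intro Suc.IH G) auto
    also have "\<dots> = F x"
      using Suc.prems by (intro swap) auto
    finally show ?case .
  qed
  have trans: "F (x \<circ> transpose i j) = F x" if "G x" "i \<in> {1..m}" "j \<in> {1..m}" for x i j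
  proof (cases i j rule: linorder_cases)
    case less
    then show ?thesis
      using shift[of x i "j - Suc i"] that by simp
  next
    case greater
    then show ?thesis
      using shift[of x j "i - Suc j"] that by (simp add: transpose_commute)
  qed simp
  from \<pi> finite_atLeastAtMost show ?thesis
    using x
  proof (induction arbitrary: x rule: permutes_induct)
    case id
    then show ?case by simp
  next
    case (swap i j p)
    have "F (x \<circ> (transpose i j \<circ> p)) = F (x \<circ> transpose i j \<circ> p)"
      by (simp only: comp_assoc)
    also have "\<dots> = F (x \<circ> transpose i j)"
      using swap.prems by (intro swap.IH G)
    also have "\<dots> = F x"
      using swap.prems swap.hyps by (intro trans)
    finally show ?case .
  qed
qed

theorem weighted_path_sum_symmetric:
  fixes x y :: "nat \<Rightarrow> 'a::field"
  assumes nz: "\<And>i j. x i + y j \<noteq> 0" and b: "strict_mono_on {1..k} b"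
    and \<pi>: "\<pi> permutes {1..a + k}"
  shows "weighted_path_sum (a + k) n k (\<lambda>i. (a + i, 1)) (\<lambda>i. (1, b i)) (\<lambda>(i, j). 1 / (x (\<pi> i) + y j)) =
    weighted_path_sum (a + k) n k (\<lambda>i. (a + i, 1)) (\<lambda>i. (1, b i)) (\<lambda>(i, j). 1 / (x i + y j))"
proof -
  define F where "F = (\<lambda>x. leibniz_det {1..k} (\<lambda>i j. one_path_sum (a + k) n x y (a + i, 1) (1, b j)))"
  have "F (x \<circ> \<pi>) = F x"
  proof (rule symmetric_of_adjacent_swaps[where G = "\<lambda>x. \<forall>i j. x i + y j \<noteq> 0", OF _ _ \<pi>])
    fix x' :: "nat \<Rightarrow> 'a" and s
    assume "\<forall>i j. x' i + y j \<noteq> 0" "1 \<le> s" "s < a + k"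
    then show "F (x' \<circ> transpose s (Suc s)) = F x'"
      unfolding F_def by (intro leibniz_det_one_path_sum_swap) auto
  qed (use nz in auto)
  then show ?thesis
    unfolding weighted_path_sum_eq_leibniz_det[OF b] by (simp only: F_def one_path_sum_def comp_apply)
qed

section \<open>Renaming variables in rational functions\<close>

lemma rename_poly_add:
  assumes "bij \<sigma>"
  shows "rename_poly \<sigma> (p + q) = rename_poly \<sigma> p + rename_poly \<sigma> q"
  unfolding rename_poly_def by (rule map_key_plus[OF bij_is_inj[OF bij_map_key[OF assms]]])

lemma rename_add:
  assumes "bij \<sigma>"
  shows "rename \<sigma> (f + g) = rename \<sigma> f + rename \<sigma> g"
  using assms by (cases f; cases g)
    (simp add: rename_Fract rename_poly_add rename_poly_mult rename_poly_eq_0_iff)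

lemma rename_mult:
  assumes "bij \<sigma>"
  shows "rename \<sigma> (f * g) = rename \<sigma> f * rename \<sigma> g"
  using assms by (cases f; cases g) (simp add: rename_Fract rename_poly_mult)

lemma rename_0:
  assumes "bij \<sigma>"
  shows "rename \<sigma> (0 :: 'k::field ratfun) = 0"
  using rename_add[OF assms, of "0 :: 'k ratfun" 0] by (metis add_0_right add_left_cancel)

lemma rename_1:
  assumes "bij \<sigma>"
  shows "rename \<sigma> (1 :: 'k::field ratfun) = 1"
proof -
  have "rename \<sigma> (Fract 1 1 :: 'k ratfun) = Fract (rename_poly \<sigma> 1) (rename_poly \<sigma> 1)"
    by (rule rename_Fract[OF assms]) simp
  also have "\<dots> = Fract 1 1"
    by (subst eq_fract) (simp_all add: rename_poly_eq_0_iff[OF assms])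
  finally show ?thesis
    by (simp add: One_fract_def)
qed

lemma rename_inverse:
  assumes "bij \<sigma>"
  shows "rename \<sigma> (1 / f) = 1 / rename \<sigma> f"
proof (cases "f = 0")
  case False
  then have "rename \<sigma> (1 / f) * rename \<sigma> f = 1"
    by (simp add: rename_mult[OF assms, symmetric] rename_1[OF assms])
  then show ?thesis
    by (metis div_by_0 mult_zero_right nonzero_eq_divide_eq zero_neq_one)
qed (simp add: rename_0[OF assms])

lemma rename_sum:
  assumes "bij \<sigma>"
  shows "rename \<sigma> (\<Sum>i\<in>I. f i) = (\<Sum>i\<in>I. rename \<sigma> (f i))"
  by (induction I rule: infinite_finite_induct) (simp_all add: rename_0 rename_add assms)

lemma rename_prod:
  assumes "bij \<sigma>"
  shows "rename \<sigma> (\<Prod>i\<in>I. f i) = (\<Prod>i\<in>I. rename \<sigma> (f i))"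
  by (induction I rule: infinite_finite_induct) (simp_all add: rename_1 rename_mult assms)

lemma Var_X_plus_Var_Y_neq_0: "Var (X i) + Var (Y j) \<noteq> (0 :: 'k::field ratfun)"
proof -
  let ?s = "\<lambda>v. Poly_Mapping.single (Poly_Mapping.single v 1) 1 :: 'k mvpoly"
  have "Poly_Mapping.single (Y j) (1 :: nat) \<noteq> Poly_Mapping.single (X i) 1"
    by (metis lookup_single_eq lookup_single_not_eq one_neq_zero xyvar.distinct(1))
  then have "Poly_Mapping.lookup (?s (X i) + ?s (Y j)) (Poly_Mapping.single (X i) 1) = 1"
    by (simp add: lookup_add lookup_single)
  then have "?s (X i) + ?s (Y j) \<noteq> 0"
    by auto
  then show ?thesis
    by (simp add: Var_def Zero_fract_def eq_fract)
qed

theorem theorem2p4: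
  fixes a k n m :: nat and b :: "nat \<Rightarrow> nat"
  assumes "k \<ge> 1" and "n \<ge> 1" and "m = a + k"
    and "\<forall>i\<in>{1..k}. 1 \<le> b i \<and> b i \<le> n"
    and "strict_mono_on {1..k} b"
  shows "symmetric_in_x m
    (path_sum m n k (\<lambda>i. (a + i, 1)) (\<lambda>i. (1, b i)) :: 'k::field ratfun)"
  unfolding symmetric_in_x_def
proof (intro allI impI)
  fix \<pi> assume \<pi>: "\<pi> permutes {1..m}"
  let ?A = "\<lambda>i. (a + i, 1)" and ?B = "\<lambda>i. (1, b i)"
  let ?x = "\<lambda>i. Var (X i) :: 'k ratfun" and ?y = "\<lambda>j. Var (Y j) :: 'k ratfun"
  have bij: "bij (permute_x \<pi>)"
    by (rule bij_permute_x[OF permutes_bij[OF \<pi>]])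
  have "rename (permute_x \<pi>) (path_sum m n k ?A ?B :: 'k ratfun) =
      weighted_path_sum m n k ?A ?B (\<lambda>(i, j). 1 / (?x (\<pi> i) + ?y j))"
    by (simp add: path_sum_def path_weight_def weighted_path_sum_def rename_sum[OF bij] rename_prod[OF bij]
        case_prod_unfold rename_inverse[OF bij] rename_add[OF bij] rename_Var[OF bij])
  also have "\<dots> = weighted_path_sum m n k ?A ?B (\<lambda>(i, j). 1 / (?x i + ?y j))"
    using weighted_path_sum_symmetric[of ?x ?y k b \<pi> a n] \<pi> assms(3,5) Var_X_plus_Var_Y_neq_0
    by blast
  also have "\<dots> = path_sum m n k ?A ?B"
    by (simp add: path_sum_def path_weight_def weighted_path_sum_def)
  finally show "rename (permute_x \<pi>) (path_sum m n k ?A ?B :: 'k ratfun) = path_sum m n k ?A ?B" .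
qed

end
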